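(* Let $(\mathcal{A},\prec,\succ,\alpha)$ be a Hom-dendriform superalgebra. Then the product $$x\circ y=x\succ y+(-1)^{|x||y|}y\prec x,\qquad x,y\in\mathcal{A}\ \text{homogeneous},$$ defines a Hom-pre-Jordan superalgebra structure $(\mathcal{A},\circ,\alpha)$ on $\mathcal{A}$.
   Context: $\mathbb{K}$ is an algebraically closed field of characteristic $0$; all spaces and linear maps are over $\mathbb{K}$. $|x|\in\mathbb{Z}_2$ is the parity of a homogeneous element $x$; identities involving parities are required for all homogeneous elements. All Hom-algebras are multiplicative: the twist map is a morphism for all products. A Hom-dendriform superalgebra is a quadruple $(\mathcal{A},\prec,\succ,\alpha)$ with $\mathcal{A}$ a $\mathbb{Z}_2$-graded vector space, $\prec,\succ:\mathcal{A}\otimes\mathcal{A}\to\mathcal{A}$ and $\alpha:\mathcal{A}\to\mathcal{A}$ even linear maps (with $\alpha(x\prec y)=\alpha(x)\prec\alpha(y)$ and $\alpha(x\succ y)=\alpha(x)\succ\alpha(y)$), such that, with $x\star y=x\prec y+x\succ y$, for all $x,y,z\in\mathcal{A}$ $$\alpha(x)\succ(y\succ z)=(x\star y)\succ\alpha(z),\quad (x\prec y)\prec\alpha(z)=\alpha(x)\prec(y\star z),\quad (x\succ y)\prec\alpha(z)=\alpha(x)\succ(y\prec z).$$ A Hom-pre-Jordan superalgebra is a triple $(\mathcal{A},\circ,\alpha)$ with $\mathcal{A}$ a $\mathbb{Z}_2$-graded vector space, $\circ$ an even bilinear product and $\alpha$ an even linear map (with $\alpha(x\circ y)=\alpha(x)\circ\alpha(y)$),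 such that, with $x\cdot y=x\circ y+(-1)^{|x||y|}y\circ x$, for all homogeneous $x,y,z,u$ both $$[\alpha(x)\cdot\alpha(y)]\circ[\alpha(z)\circ\alpha(u)]+(-1)^{|x|(|y|+|z|)}[\alpha(y)\cdot\alpha(z)]\circ[\alpha(x)\circ\alpha(u)]+(-1)^{|z|(|x|+|y|)}[\alpha(z)\cdot\alpha(x)]\circ[\alpha(y)\circ\alpha(u)]$$ and $$\alpha^2(x)\circ[\alpha(y)\circ(z\circ u)]+(-1)^{|z|(|x|+|y|)+|x||y|}\alpha^2(z)\circ[\alpha(y)\circ(x\circ u)]+(-1)^{|y||z|}[(x\cdot z)\cdot\alpha(y)]\circ\alpha^2(u)$$ are equal to $$\alpha^2(x)\circ[(y\cdot z)\circ\alpha(u)]+(-1)^{|x|(|y|+|z|)}\alpha^2(y)\circ[(z\cdot x)\circ\alpha(u)]+(-1)^{|z|(|x|+|y|)}\alpha^2(z)\circ[(x\cdot y)\circ\alpha(u)].$$ *)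

theory Defs
  imports "HOL-Library.Z2" "HOL-Computational_Algebra.Polynomial"
begin

text \<open>
  A \<open>\<int>\<^sub>2\<close>-graded vector space: the underlying space is the whole type \<open>'a\<close>, parities are elements
  of the field \<^typ>\<open>bit\<close> (so that exponents of signs can be computed in \<open>\<int>\<^sub>2\<close>), and \<open>V i\<close> is the
  subspace of homogeneous elements of parity \<open>i\<close>. Since \<open>0\<close> lies in both components, the parity
  of an element is not a function of the element; identities on homogeneous elements quantify over
  \<open>x \<in> V p\<close> with \<open>p\<close> in the role of \<open>\<bar>x\<bar>\<close>.
\<close>

locale super_vector_space = vector_space scale
  for scale :: "'k::field \<Rightarrow> 'a::ab_group_add \<Rightarrow> 'a" +
  fixes V :: "bit \<Rightarrow> 'a set"
  assumes subspace_V: "subspace (V i)"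
    and direct: "V 0 \<inter> V 1 = {0}"
    and decomp: "\<exists>a\<in>V 0. \<exists>b\<in>V 1. x = a + b"
begin

definition ssign :: "bit \<Rightarrow> 'a \<Rightarrow> 'a"  \<comment> \<open>\<open>x \<mapsto> (-1)\<^sup>p x\<close>\<close>
  where "ssign p x = scale (if p = 0 then 1 else - 1) x"

definition even_linear :: "('a \<Rightarrow> 'a) \<Rightarrow> bool"
  where "even_linear f \<longleftrightarrow>
    Vector_Spaces.linear scale scale f \<and> (\<forall>p. \<forall>x\<in>V p. f x \<in> V p)"

definition even_bilinear :: "('a \<Rightarrow> 'a \<Rightarrow> 'a) \<Rightarrow> bool"
  where "even_bilinear m \<longleftrightarrow>
    (\<forall>x. Vector_Spaces.linear scale scale (\<lambda>y. m x y)) \<and>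
    (\<forall>y. Vector_Spaces.linear scale scale (\<lambda>x. m x y)) \<and>
    (\<forall>p q. \<forall>x\<in>V p. \<forall>y\<in>V q. m x y \<in> V (p + q))"

end

locale hom_superalgebra = super_vector_space scale V
  for scale :: "'k::field \<Rightarrow> 'a::ab_group_add \<Rightarrow> 'a" and V :: "bit \<Rightarrow> 'a set" +
  fixes m :: "'a \<Rightarrow> 'a \<Rightarrow> 'a" and \<alpha> :: "'a \<Rightarrow> 'a"
  assumes even_bilinear_m: "even_bilinear m"
    and even_linear_\<alpha>: "even_linear \<alpha>"
    and multiplicative: "\<alpha> (m x y) = m (\<alpha> x) (\<alpha> y)"
begin

text \<open>
  The product \<open>x \<cdot> y = x \<circ> y + (-1)\<^bsup>\<bar>x\<bar>\<bar>y\<bar>\<^esup> y \<circ> x\<close> for \<open>x\<close> and \<open>y\<close> homogeneous of parities \<open>p\<close> and \<open>q\<close>,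
  which are passed as arguments.
\<close>

definition dot :: "bit \<Rightarrow> bit \<Rightarrow> 'a \<Rightarrow> 'a \<Rightarrow> 'a"
  where "dot p q x y = m x y + ssign (p * q) (m y x)"

end

locale hom_dendriform_superalgebra =
  prec: hom_superalgebra scale V prec \<alpha> + succ: hom_superalgebra scale V succ \<alpha>
  for scale :: "'k::field \<Rightarrow> 'a::ab_group_add \<Rightarrow> 'a" and V :: "bit \<Rightarrow> 'a set"
    and prec :: "'a \<Rightarrow> 'a \<Rightarrow> 'a" (infixl \<open>\<prec>\<close> 70)
    and succ :: "'a \<Rightarrow> 'a \<Rightarrow> 'a" (infixl \<open>\<succ>\<close> 70)
    and \<alpha> :: "'a \<Rightarrow> 'a" +
  assumes dendriform_1: "\<alpha> x \<succ> (y \<succ> z) = (x \<prec> y + x \<succ> y) \<succ> \<alpha> z"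
    and dendriform_2: "(x \<prec> y) \<prec> \<alpha> z = \<alpha> x \<prec> (y \<prec> z + y \<succ> z)"
    and dendriform_3: "(x \<succ> y) \<prec> \<alpha> z = \<alpha> x \<succ> (y \<prec> z)"

locale hom_pre_Jordan_superalgebra = hom_superalgebra scale V circ \<alpha>
  for scale :: "'k::field \<Rightarrow> 'a::ab_group_add \<Rightarrow> 'a" and V :: "bit \<Rightarrow> 'a set"
    and circ :: "'a \<Rightarrow> 'a \<Rightarrow> 'a" (infixl \<open>\<circ>\<^sub>J\<close> 70)
    and \<alpha> :: "'a \<Rightarrow> 'a" +
  assumes pre_Jordan_1: "\<lbrakk>x \<in> V p; y \<in> V q; z \<in> V r; u \<in> V s\<rbrakk> \<Longrightarrow>
      dot p q (\<alpha> x) (\<alpha> y) \<circ>\<^sub>J (\<alpha> z \<circ>\<^sub>J \<alpha> u)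
      + ssign (p * (q + r)) (dot q r (\<alpha> y) (\<alpha> z) \<circ>\<^sub>J (\<alpha> x \<circ>\<^sub>J \<alpha> u))
      + ssign (r * (p + q)) (dot r p (\<alpha> z) (\<alpha> x) \<circ>\<^sub>J (\<alpha> y \<circ>\<^sub>J \<alpha> u))
    = \<alpha> (\<alpha> x) \<circ>\<^sub>J (dot q r y z \<circ>\<^sub>J \<alpha> u)
      + ssign (p * (q + r)) (\<alpha> (\<alpha> y) \<circ>\<^sub>J (dot r p z x \<circ>\<^sub>J \<alpha> u))
      + ssign (r * (p + q)) (\<alpha> (\<alpha> z) \<circ>\<^sub>J (dot p q x y \<circ>\<^sub>J \<alpha> u))"
    and pre_Jordan_2: "\<lbrakk>x \<in> V p; y \<in> V q; z \<in> V r; u \<in> V s\<rbrakk> \<Longrightarrow>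
      \<alpha> (\<alpha> x) \<circ>\<^sub>J (\<alpha> y \<circ>\<^sub>J (z \<circ>\<^sub>J u))
      + ssign (r * (p + q) + p * q) (\<alpha> (\<alpha> z) \<circ>\<^sub>J (\<alpha> y \<circ>\<^sub>J (x \<circ>\<^sub>J u)))
      + ssign (q * r) (dot (p + r) q (dot p r x z) (\<alpha> y) \<circ>\<^sub>J \<alpha> (\<alpha> u))
    = \<alpha> (\<alpha> x) \<circ>\<^sub>J (dot q r y z \<circ>\<^sub>J \<alpha> u)
      + ssign (p * (q + r)) (\<alpha> (\<alpha> y) \<circ>\<^sub>J (dot r p z x \<circ>\<^sub>J \<alpha> u))
      + ssign (r * (p + q)) (\<alpha> (\<alpha> z) \<circ>\<^sub>J (dot p q x y \<circ>\<^sub>J \<alpha> u))"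

context hom_dendriform_superalgebra
begin

text \<open>
  The bilinear products on the whole space that are given on homogeneous elements by
  \<open>x \<circ> y = x \<succ> y + (-1)\<^bsup>\<bar>x\<bar>\<bar>y\<bar>\<^esup> y \<prec> x\<close>.
\<close>

definition induced_product :: "('a \<Rightarrow> 'a \<Rightarrow> 'a) \<Rightarrow> bool"
  where "induced_product circ \<longleftrightarrow>
    (\<forall>x. Vector_Spaces.linear scale scale (\<lambda>y. circ x y)) \<and>
    (\<forall>y. Vector_Spaces.linear scale scale (\<lambda>x. circ x y)) \<and>
    (\<forall>p q. \<forall>x\<in>V p. \<forall>y\<in>V q. circ x y = x \<succ> y + prec.ssign (p * q) (y \<prec> x))"

end

end

theory Submission
  imports Defs
begin

text \<open>
  The sum \<open>x \<star> y = x \<prec> y + x \<succ> y\<close> is Hom-associative, and \<open>\<A>\<close> is a Hom-bimodule over it with left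
  action \<open>x \<succ> u\<close> and right action \<open>u \<prec> x\<close>: that is what the three dendriform axioms say. In the super
  setting it pays to write the right action as an operator on the left with the sign built in,
  \<open>rmul x u = (-1)\<^bsup>\<bar>x\<bar>\<bar>u\<bar>\<^esup> u \<prec> x\<close>. Then \<open>x \<circ> u = x \<succ> u + rmul x u\<close>, and moving \<open>rmul\<close> past \<open>\<succ>\<close>
  or past another \<open>rmul\<close> costs a sign that depends only on the two operators and no longer on \<open>\<bar>u\<bar>\<close>
  (\<open>rmul_succ\<close>, \<open>rmul_rmul\<close>).

  The symmetrization of \<open>\<circ>\<close> is also that of \<open>\<star>\<close> (\<open>dot_eq\<close>), because the two products differ only
  in that \<open>\<circ>\<close> takes \<open>\<prec>\<close> with its factors exchanged. So the two pre-Jordan identities say that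
  \<open>x \<mapsto> (u \<mapsto> x \<circ> u)\<close> represents the Hom-Jordan superalgebra that \<open>\<star>\<close> symmetrizes to. Every nested product \<open>x \<circ> (y \<circ> u)\<close> or \<open>x \<circ> (y \<circ> (z \<circ> u))\<close> is brought to a normal form
  (\<open>circ_circ\<close>, \<open>circ_circ_circ\<close>) consisting, up to twists by \<open>\<alpha>\<close>, of a pure left term \<open>w \<succ> u\<close>, a pure right term
  \<open>rmul w' u\<close> with the factors of \<open>w\<close> reversed, and mixed terms \<open>v \<succ> rmul w u\<close>. In each identity the
  mixed terms match one by one, and the pure terms match by Hom-associativity of \<open>\<star>\<close>.

  Since \<open>\<circ>\<close> is prescribed on homogeneous elements only, it must also be extended to the whole space.
  The sign \<open>(-1)\<^bsup>\<bar>x\<bar>\<bar>y\<bar>\<^esup>\<close> differs from \<open>1\<close> only when both factors are odd, so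
  \<open>x \<succ> y + y \<prec> x - 2 (y\<^sub>1 \<prec> x\<^sub>1)\<close>, with \<open>x\<^sub>1\<close> and \<open>y\<^sub>1\<close> the odd parts, is a bilinear extension;
  it is the only one because homogeneous elements span.
\<close>

section \<open>Signs and odd parts in a super vector space\<close>

text \<open>
  The signs are to be computed by ring arithmetic on parities; these two rules would rewrite
  \<open>+\<close> and \<open>*\<close> to bit operations first.
\<close>

declare add_bit_eq_xor [simp del] mult_bit_eq_and [simp del]

context super_vector_space
begin

sublocale endo: vector_space_pair scale scale ..

lemma ssign_0 [simp]: "ssign 0 x = x"
  and ssign_1 [simp]: "ssign 1 x = - x"
  by (simp_all add: ssign_def)

lemma linear_ssign:
  assumes "Vector_Spaces.linear scale scale f"
  shows "f (ssign p x) = ssign p (f x)"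
  using endo.linear_scale[OF assms] by (simp add: ssign_def)

lemma ssign_in_V: "x \<in> V p \<Longrightarrow> ssign q x \<in> V p"
  using subspace_V by (simp add: ssign_def subspace_scale)

definition odd_part :: "'a \<Rightarrow> 'a"
  where "odd_part x = (THE b. b \<in> V 1 \<and> x - b \<in> V 0)"

lemma odd_part_eqI:
  assumes "b \<in> V 1" "x - b \<in> V 0"
  shows "odd_part x = b"
  unfolding odd_part_def
proof (rule the_equality)
  fix c assume c: "c \<in> V 1 \<and> x - c \<in> V 0"
  have "(x - b) - (x - c) \<in> V 0"
    using subspace_diff[OF subspace_V[of 0]] assms c by blast
  moreover have "c - b \<in> V 1"
    using subspace_diff[OF subspace_V[of 1]] assms c by blast
  ultimately have "c - b \<in> V 0 \<inter> V 1" by simp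
  then show "c = b" using direct by simp
qed (use assms in simp)

lemma odd_part_in: "odd_part x \<in> V 1" "x - odd_part x \<in> V 0"
proof -
  obtain a b where "a \<in> V 0" "b \<in> V 1" "x = a + b" using decomp by blast
  then have "odd_part x = b" by (intro odd_part_eqI) auto
  with \<open>a \<in> V 0\<close> \<open>b \<in> V 1\<close> \<open>x = a + b\<close> show "odd_part x \<in> V 1" "x - odd_part x \<in> V 0" by auto
qed

lemma linear_odd_part: "Vector_Spaces.linear scale scale odd_part"
proof -
  have "(x - odd_part x) + (y - odd_part y) \<in> V 0" "scale c (x - odd_part x) \<in> V 0"
    "odd_part x + odd_part y \<in> V 1" "scale c (odd_part x) \<in> V 1" for x y c
    using subspace_add subspace_scale subspace_V odd_part_in by blast+
  then have "odd_part (x + y) = odd_part x + odd_part y"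
    "odd_part (scale c x) = scale c (odd_part x)" for x y c
    by (auto intro!: odd_part_eqI simp: algebra_simps)
  then show ?thesis
    by (simp add: Vector_Spaces.linear_iff vector_space_axioms)
qed

lemma odd_part_homogeneous:
  "x \<in> V 0 \<Longrightarrow> odd_part x = 0" "x \<in> V 1 \<Longrightarrow> odd_part x = x"
  using subspace_0[OF subspace_V] by (auto intro!: odd_part_eqI)

text \<open>Homogeneous elements span, so bilinear identities need only be checked on them.\<close>

lemma bilinear_ext:
  assumes f: "\<And>x. Vector_Spaces.linear scale scale (f x)"
      "\<And>y. Vector_Spaces.linear scale scale (\<lambda>x. f x y)"
    and g: "\<And>x. Vector_Spaces.linear scale scale (g x)"
      "\<And>y. Vector_Spaces.linear scale scale (\<lambda>x. g x y)"
    and eq: "\<And>p q x y. x \<in> V p \<Longrightarrow> y \<in> V q \<Longrightarrow> f x y = g x y"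
  shows "f x y = g x y"
proof -
  obtain a b where "a \<in> V 0" "b \<in> V 1" "x = a + b" using decomp by blast
  moreover obtain c d where "c \<in> V 0" "d \<in> V 1" "y = c + d" using decomp by blast
  ultimately show ?thesis
    using endo.linear_add[OF f(1)] endo.linear_add[OF f(2)] endo.linear_add[OF g(1)] endo.linear_add[OF g(2)]
    by (simp add: eq)
qed

end

section \<open>The bilinear extension of the product\<close>

context hom_dendriform_superalgebra
begin

lemma linear_prec: "Vector_Spaces.linear scale scale (\<lambda>y. x \<prec> y)"
    "Vector_Spaces.linear scale scale (\<lambda>x. x \<prec> y)"
  and linear_succ: "Vector_Spaces.linear scale scale (\<lambda>y. x \<succ> y)"
    "Vector_Spaces.linear scale scale (\<lambda>x. x \<succ> y)"
  and linear_\<alpha>: "Vector_Spaces.linear scale scale \<alpha>"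
  using prec.even_bilinear_m succ.even_bilinear_m prec.even_linear_\<alpha>
  by (simp_all add: prec.even_bilinear_def prec.even_linear_def)

lemma prec_in_V: "x \<in> V p \<Longrightarrow> y \<in> V q \<Longrightarrow> x \<prec> y \<in> V (p + q)"
  and succ_in_V: "x \<in> V p \<Longrightarrow> y \<in> V q \<Longrightarrow> x \<succ> y \<in> V (p + q)"
  and \<alpha>_in_V: "x \<in> V p \<Longrightarrow> \<alpha> x \<in> V p"
  using prec.even_bilinear_m succ.even_bilinear_m prec.even_linear_\<alpha>
  by (simp_all add: prec.even_bilinear_def prec.even_linear_def)

lemma ex1_induced_product: "\<exists>!circ. induced_product circ"
proof (rule ex_ex1I)
  let ?o = prec.odd_part
  \<comment> \<open>subtracting \<open>y\<^sub>1 \<prec> x\<^sub>1\<close> twice turns the coefficient \<open>1\<close> of the odd-odd component into \<open>-1\<close>\<close>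
  let ?circ = "\<lambda>x y. x \<succ> y + (y \<prec> x - (?o y \<prec> ?o x + ?o y \<prec> ?o x))"
  note lin = prec.endo.linear_compose_add prec.endo.linear_compose_sub linear_prec linear_succ
    Vector_Spaces.linear_compose[OF prec.linear_odd_part linear_prec(1), unfolded o_def]
    Vector_Spaces.linear_compose[OF prec.linear_odd_part linear_prec(2), unfolded o_def]
  have "?circ x y = x \<succ> y + prec.ssign (p * q) (y \<prec> x)"
    if "x \<in> V p" "y \<in> V q" for p q x y
    using that prec.endo.linear_0[OF linear_prec(1)] prec.endo.linear_0[OF linear_prec(2)]
    by (cases p; cases q) (simp_all add: prec.odd_part_homogeneous)
  then have "induced_product ?circ"
    unfolding induced_product_def by (intro conjI allI ballI lin)
  then show "\<exists>circ. induced_product circ" by (rule exI[of induced_product])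
next
  fix f g assume fg: "induced_product f" "induced_product g"
  have "f x y = g x y" for x y
    by (rule prec.bilinear_ext) (use fg in \<open>auto simp: induced_product_def\<close>)
  then show "f = g" by blast
qed

section \<open>The underlying Hom-associative product\<close>

definition star :: "'a \<Rightarrow> 'a \<Rightarrow> 'a" (infixl \<open>\<star>\<close> 70)
  where "x \<star> y = x \<prec> y + x \<succ> y"

lemma linear_star: "Vector_Spaces.linear scale scale (\<lambda>y. x \<star> y)"
    "Vector_Spaces.linear scale scale (\<lambda>x. x \<star> y)"
  unfolding star_def by (intro prec.endo.linear_compose_add linear_prec linear_succ)+

lemma star_in_V: "x \<in> V p \<Longrightarrow> y \<in> V q \<Longrightarrow> x \<star> y \<in> V (p + q)"
  unfolding star_def by (intro prec.subspace_add prec.subspace_V prec_in_V succ_in_V)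

lemma \<alpha>_star: "\<alpha> (x \<star> y) = \<alpha> x \<star> \<alpha> y"
  by (simp add: star_def prec.endo.linear_add[OF linear_\<alpha>] prec.multiplicative succ.multiplicative)

text \<open>
  Both sides split into three pieces, according to whether the arrows point to \<open>x\<close>, to \<open>y\<close>
  or to \<open>z\<close>; each dendriform axiom equates one pair of pieces.
\<close>

lemma star_assoc: "(x \<star> y) \<star> \<alpha> z = \<alpha> x \<star> (y \<star> z)"
  by (simp add: star_def prec.endo.linear_add[OF linear_prec(1)] prec.endo.linear_add[OF linear_prec(2)]
      prec.endo.linear_add[OF linear_succ(1)] prec.endo.linear_add[OF linear_succ(2)]
      dendriform_1 dendriform_2 dendriform_3 add.assoc)

section \<open>Left and signed right multiplications\<close>

context
  fixes circ :: "'a \<Rightarrow> 'a \<Rightarrow> 'a" (infixl \<open>\<circ>\<^sub>J\<close> 70)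
  assumes induced: "induced_product circ"
begin

lemma linear_circ: "Vector_Spaces.linear scale scale (\<lambda>y. x \<circ>\<^sub>J y)"
    "Vector_Spaces.linear scale scale (\<lambda>x. x \<circ>\<^sub>J y)"
  and circ_homogeneous:
    "x \<in> V p \<Longrightarrow> y \<in> V q \<Longrightarrow> x \<circ>\<^sub>J y = x \<succ> y + prec.ssign (p * q) (y \<prec> x)"
  using induced by (simp_all add: induced_product_def)

lemma hom_superalgebra_circ: "hom_superalgebra scale V circ \<alpha>"
proof unfold_locales
  have "x \<circ>\<^sub>J y \<in> V (p + q)" if "x \<in> V p" "y \<in> V q" for p q x y
    using that prec_in_V[of y q x p] succ_in_V[of x p y q]
    by (simp add: circ_homogeneous add.commute prec.subspace_add prec.subspace_V prec.ssign_in_V)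
  then show "prec.even_bilinear circ"
    by (simp add: prec.even_bilinear_def linear_circ)
  show "prec.even_linear \<alpha>" by (rule prec.even_linear_\<alpha>)
  show "\<alpha> (x \<circ>\<^sub>J y) = \<alpha> x \<circ>\<^sub>J \<alpha> y" for x y
  proof (rule prec.bilinear_ext[where f = "\<lambda>x y. \<alpha> (x \<circ>\<^sub>J y)" and g = "\<lambda>x y. \<alpha> x \<circ>\<^sub>J \<alpha> y"])
    fix p q x y assume "x \<in> V p" "y \<in> V q"
    then show "\<alpha> (x \<circ>\<^sub>J y) = \<alpha> x \<circ>\<^sub>J \<alpha> y"
      by (simp add: circ_homogeneous circ_homogeneous[OF \<alpha>_in_V \<alpha>_in_V] prec.endo.linear_add[OF linear_\<alpha>]
          prec.linear_ssign[OF linear_\<alpha>] prec.multiplicative succ.multiplicative)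
  qed (use Vector_Spaces.linear_compose[OF linear_circ(1) linear_\<alpha>]
        Vector_Spaces.linear_compose[OF linear_circ(2) linear_\<alpha>]
        Vector_Spaces.linear_compose[OF linear_\<alpha> linear_circ(1)]
        Vector_Spaces.linear_compose[OF linear_\<alpha> linear_circ(2)] in \<open>simp_all add: o_def\<close>)
qed

interpretation circ: hom_superalgebra scale V circ \<alpha>
  by (rule hom_superalgebra_circ)

text \<open>
  The signed right action \<open>(-1)\<^bsup>\<bar>x\<bar>\<bar>u\<bar>\<^esup> u \<prec> x\<close>. Defining it as a difference makes it bilinear on the
  whole space, whereas the formula with the sign makes sense for homogeneous \<open>x\<close> and \<open>u\<close> only.
\<close>

definition rmul :: "'a \<Rightarrow> 'a \<Rightarrow> 'a"
  where "rmul x u = x \<circ>\<^sub>J u - x \<succ> u"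

lemma circ_eq: "x \<circ>\<^sub>J u = x \<succ> u + rmul x u"
  by (simp add: rmul_def)

lemma rmul_homogeneous: "x \<in> V p \<Longrightarrow> u \<in> V s \<Longrightarrow> rmul x u = prec.ssign (p * s) (u \<prec> x)"
  by (simp add: rmul_def circ_homogeneous)

lemma linear_rmul: "Vector_Spaces.linear scale scale (\<lambda>u. rmul x u)"
    "Vector_Spaces.linear scale scale (\<lambda>x. rmul x u)"
  unfolding rmul_def by (intro prec.endo.linear_compose_sub linear_circ linear_succ)+

lemma rmul_in_V: "x \<in> V p \<Longrightarrow> u \<in> V s \<Longrightarrow> rmul x u \<in> V (s + p)"
  by (simp add: rmul_homogeneous prec.ssign_in_V prec_in_V)

lemma \<alpha>_rmul: "\<alpha> (rmul x u) = rmul (\<alpha> x) (\<alpha> u)"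
  by (simp add: rmul_def prec.endo.linear_diff[OF linear_\<alpha>] circ.multiplicative succ.multiplicative)

lemmas bilinear_simps =
  prec.endo.linear_add[OF linear_\<alpha>] prec.endo.linear_diff[OF linear_\<alpha>]
  prec.endo.linear_neg[OF linear_\<alpha>]
  prec.endo.linear_add[OF linear_succ(1)] prec.endo.linear_diff[OF linear_succ(1)]
  prec.endo.linear_neg[OF linear_succ(1)]
  prec.endo.linear_add[OF linear_succ(2)] prec.endo.linear_diff[OF linear_succ(2)]
  prec.endo.linear_neg[OF linear_succ(2)]
  prec.endo.linear_add[OF linear_rmul(1)] prec.endo.linear_diff[OF linear_rmul(1)]
  prec.endo.linear_neg[OF linear_rmul(1)]
  prec.endo.linear_add[OF linear_rmul(2)] prec.endo.linear_diff[OF linear_rmul(2)]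
  prec.endo.linear_neg[OF linear_rmul(2)]
  prec.endo.linear_add[OF linear_star(1)] prec.endo.linear_diff[OF linear_star(1)]
  prec.endo.linear_neg[OF linear_star(1)]
  prec.endo.linear_add[OF linear_star(2)] prec.endo.linear_diff[OF linear_star(2)]
  prec.endo.linear_neg[OF linear_star(2)]

lemma succ_succ: "\<alpha> x \<succ> (y \<succ> u) = (x \<star> y) \<succ> \<alpha> u"
  by (simp add: star_def dendriform_1)

text \<open>
  The parity of \<open>u\<close> enters both sides through the same sign \<open>(-1)\<^bsup>(\<bar>x\<bar>+\<bar>y\<bar>)\<bar>u\<bar>\<^esup>\<close> and cancels; what is
  left is the sign of exchanging \<open>x\<close> and \<open>y\<close>. The same happens in \<open>rmul_succ\<close>.
\<close>

lemma rmul_rmul: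
  assumes "x \<in> V p" "y \<in> V q" "u \<in> V s"
  shows "rmul (\<alpha> x) (rmul y u) = prec.ssign (p * q) (rmul (y \<star> x) (\<alpha> u))"
proof -
  have "rmul (\<alpha> x) (u \<prec> y) = prec.ssign (p * (s + q)) ((u \<prec> y) \<prec> \<alpha> x)"
    "rmul (y \<star> x) (\<alpha> u) = prec.ssign ((q + p) * s) (\<alpha> u \<prec> (y \<star> x))"
    using assms by (auto intro!: rmul_homogeneous prec_in_V star_in_V \<alpha>_in_V)
  then show ?thesis
    by (cases p; cases q; cases s)
      (simp_all add: rmul_homogeneous[OF assms(2,3)] dendriform_2 star_def
        prec.endo.linear_neg[OF linear_rmul(1)])
qed

lemma rmul_succ:
  assumes "x \<in> V p" "y \<in> V q" "u \<in> V s"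
  shows "rmul (\<alpha> x) (y \<succ> u) = prec.ssign (p * q) (\<alpha> y \<succ> rmul x u)"
proof -
  have "rmul (\<alpha> x) (y \<succ> u) = prec.ssign (p * (q + s)) ((y \<succ> u) \<prec> \<alpha> x)"
    using assms by (intro rmul_homogeneous succ_in_V \<alpha>_in_V)
  then show ?thesis
    by (cases p; cases q; cases s)
      (simp_all add: rmul_homogeneous[OF assms(1,3)] dendriform_3
        prec.endo.linear_neg[OF linear_succ(1)])
qed

text \<open>
  The two mixed terms are kept in the form \<open>_ \<succ> rmul _ _\<close>, with the left action outermost, so that
  exchanging \<open>x\<close> and \<open>y\<close> only multiplies their sum by the sign of the exchange.
\<close>

lemma circ_circ:
  assumes "x \<in> V p" "y \<in> V q" "u \<in> V s"
  shows "\<alpha> x \<circ>\<^sub>J (y \<circ>\<^sub>J u) = (x \<star> y) \<succ> \<alpha> u + prec.ssign (p * q) (rmul (y \<star> x) (\<alpha> u))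
    + (\<alpha> x \<succ> rmul y u + prec.ssign (p * q) (\<alpha> y \<succ> rmul x u))"
  using rmul_rmul[OF assms] rmul_succ[OF assms] by (simp add: circ_eq bilinear_simps succ_succ add_ac)

text \<open>
  The eight terms are obtained by choosing for each of \<open>x\<close>, \<open>y\<close>, \<open>z\<close> whether it acts from the left or
  from the right. The factors acting from the left keep their order, those acting from the right
  are multiplied in the reverse order, and the sign is that of the resulting permutation.
\<close>

lemma circ_circ_circ:
  assumes "x \<in> V p" "y \<in> V q" "z \<in> V r" "u \<in> V s"
  shows "\<alpha> (\<alpha> x) \<circ>\<^sub>J (\<alpha> y \<circ>\<^sub>J (z \<circ>\<^sub>J u)) =
      (\<alpha> x \<star> (y \<star> z)) \<succ> \<alpha> (\<alpha> u)
    + prec.ssign (p * q + p * r + q * r) (rmul ((z \<star> y) \<star> \<alpha> x) (\<alpha> (\<alpha> u)))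
    + ((\<alpha> x \<star> \<alpha> y) \<succ> rmul (\<alpha> z) (\<alpha> u)
      + prec.ssign (q * r) ((\<alpha> x \<star> \<alpha> z) \<succ> rmul (\<alpha> y) (\<alpha> u))
      + prec.ssign (p * q + p * r) ((\<alpha> y \<star> \<alpha> z) \<succ> rmul (\<alpha> x) (\<alpha> u)))
    + (prec.ssign (q * r) (\<alpha> (\<alpha> x) \<succ> rmul (z \<star> y) (\<alpha> u))
      + prec.ssign (p * q + p * r) (\<alpha> (\<alpha> y) \<succ> rmul (z \<star> x) (\<alpha> u))
      + prec.ssign (p * q + p * r + q * r) (\<alpha> (\<alpha> z) \<succ> rmul (y \<star> x) (\<alpha> u)))"
proof -
  have "rmul (\<alpha> (\<alpha> x)) ((y \<star> z) \<succ> \<alpha> u)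
      = prec.ssign (p * (q + r)) (\<alpha> (y \<star> z) \<succ> rmul (\<alpha> x) (\<alpha> u))"
    "rmul (\<alpha> (\<alpha> x)) (rmul (z \<star> y) (\<alpha> u))
      = prec.ssign (p * (r + q)) (rmul ((z \<star> y) \<star> \<alpha> x) (\<alpha> (\<alpha> u)))"
    "rmul (\<alpha> (\<alpha> x)) (\<alpha> y \<succ> rmul z u) = prec.ssign (p * q) (\<alpha> (\<alpha> y) \<succ> rmul (\<alpha> x) (rmul z u))"
    "rmul (\<alpha> (\<alpha> x)) (\<alpha> z \<succ> rmul y u) = prec.ssign (p * r) (\<alpha> (\<alpha> z) \<succ> rmul (\<alpha> x) (rmul y u))"
    using assms by (auto intro!: rmul_succ rmul_rmul \<alpha>_in_V star_in_V rmul_in_V)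
  then show ?thesis
    unfolding circ_circ[OF assms(2,3,4)] circ_eq[of "\<alpha> (\<alpha> x)"]
    by (cases p; cases q; cases r)
      (simp_all add: bilinear_simps succ_succ rmul_rmul[OF assms(1,3,4)] rmul_rmul[OF assms(1,2,4)]
        \<alpha>_star \<alpha>_rmul algebra_simps)
qed

section \<open>The pre-Jordan identities\<close>

lemma dot_eq:
  assumes "x \<in> V p" "y \<in> V q"
  shows "circ.dot p q x y = x \<star> y + prec.ssign (p * q) (y \<star> x)"
  using assms by (cases p; cases q) (simp_all add: circ.dot_def circ_homogeneous star_def)

lemma dot_in_V: "x \<in> V p \<Longrightarrow> y \<in> V q \<Longrightarrow> circ.dot p q x y \<in> V (p + q)"
  using star_in_V[of x p y q] star_in_V[of y q x p]
  by (simp add: dot_eq prec.subspace_add prec.subspace_V prec.ssign_in_V add.commute)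

lemma \<alpha>_dot: "\<alpha> (circ.dot p q x y) = circ.dot p q (\<alpha> x) (\<alpha> y)"
  by (simp add: circ.dot_def prec.endo.linear_add[OF linear_\<alpha>] prec.linear_ssign[OF linear_\<alpha>]
      circ.multiplicative)

text \<open>
  By \<open>circ_circ\<close> the mixed terms on both sides are, up to sign, the products
  \<open>\<alpha>(a \<cdot> b) \<succ> rmul (\<alpha> c) (\<alpha> u)\<close> and \<open>\<alpha>\<^sup>2(c) \<succ> rmul (a \<cdot> b) (\<alpha> u)\<close> over the cyclic rotations
  \<open>(a, b, c)\<close> of \<open>(x, y, z)\<close>. The pure terms have the factors \<open>(a \<cdot> b) \<star> \<alpha>(c)\<close> and
  \<open>\<alpha>(c) \<star> (a \<cdot> b)\<close>, and by Hom-associativity both families sum to the signed sum over all six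
  orderings of \<open>x\<close>, \<open>y\<close>, \<open>z\<close>.
\<close>

lemma pre_Jordan_1_circ:
  assumes "x \<in> V p" "y \<in> V q" "z \<in> V r" "u \<in> V s"
  shows "circ.dot p q (\<alpha> x) (\<alpha> y) \<circ>\<^sub>J (\<alpha> z \<circ>\<^sub>J \<alpha> u)
      + prec.ssign (p * (q + r)) (circ.dot q r (\<alpha> y) (\<alpha> z) \<circ>\<^sub>J (\<alpha> x \<circ>\<^sub>J \<alpha> u))
      + prec.ssign (r * (p + q)) (circ.dot r p (\<alpha> z) (\<alpha> x) \<circ>\<^sub>J (\<alpha> y \<circ>\<^sub>J \<alpha> u))
    = \<alpha> (\<alpha> x) \<circ>\<^sub>J (circ.dot q r y z \<circ>\<^sub>J \<alpha> u)
      + prec.ssign (p * (q + r)) (\<alpha> (\<alpha> y) \<circ>\<^sub>J (circ.dot r p z x \<circ>\<^sub>J \<alpha> u))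
      + prec.ssign (r * (p + q)) (\<alpha> (\<alpha> z) \<circ>\<^sub>J (circ.dot p q x y \<circ>\<^sub>J \<alpha> u))"
proof -
  note hom = assms assms[THEN \<alpha>_in_V]
  note c = circ_circ[OF _ _ hom(8)]
  note d = dot_in_V[OF hom(1,2)] dot_in_V[OF hom(2,3)] dot_in_V[OF hom(3,1)]
  show ?thesis
    unfolding \<alpha>_dot[symmetric] c[OF d(1) hom(7)] c[OF d(2) hom(5)] c[OF d(3) hom(6)]
      c[OF hom(5) d(2)] c[OF hom(6) d(3)] c[OF hom(7) d(1)]
    using assms
    by (cases p; cases q; cases r)
      (simp_all add: dot_eq bilinear_simps \<alpha>_star star_assoc algebra_simps)
qed

text \<open>
  The third summand on the left is a single product and has no mixed terms, so the mixed terms of the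
  first two must match those on the right, and they do one by one. Among the pure left terms, the first two
  summands give the orderings \<open>xyz\<close> and \<open>zyx\<close>, and \<open>(x \<cdot> z) \<cdot> \<alpha>(y)\<close> supplies the other four: together
  these are the six orderings that appear on the right. The pure right terms are the same six, reversed.
\<close>

lemma pre_Jordan_2_circ:
  assumes "x \<in> V p" "y \<in> V q" "z \<in> V r" "u \<in> V s"
  shows "\<alpha> (\<alpha> x) \<circ>\<^sub>J (\<alpha> y \<circ>\<^sub>J (z \<circ>\<^sub>J u))
      + prec.ssign (r * (p + q) + p * q) (\<alpha> (\<alpha> z) \<circ>\<^sub>J (\<alpha> y \<circ>\<^sub>J (x \<circ>\<^sub>J u)))
      + prec.ssign (q * r) (circ.dot (p + r) q (circ.dot p r x z) (\<alpha> y) \<circ>\<^sub>J \<alpha> (\<alpha> u))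
    = \<alpha> (\<alpha> x) \<circ>\<^sub>J (circ.dot q r y z \<circ>\<^sub>J \<alpha> u)
      + prec.ssign (p * (q + r)) (\<alpha> (\<alpha> y) \<circ>\<^sub>J (circ.dot r p z x \<circ>\<^sub>J \<alpha> u))
      + prec.ssign (r * (p + q)) (\<alpha> (\<alpha> z) \<circ>\<^sub>J (circ.dot p q x y \<circ>\<^sub>J \<alpha> u))"
proof -
  note hom = assms assms[THEN \<alpha>_in_V]
  note c = circ_circ[OF _ _ hom(8)]
  have d: "circ.dot (p + r) q (circ.dot p r x z) (\<alpha> y)
      = circ.dot p r x z \<star> \<alpha> y + prec.ssign ((p + r) * q) (\<alpha> y \<star> circ.dot p r x z)"
    using assms by (intro dot_eq dot_in_V \<alpha>_in_V)
  show ?thesis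
    unfolding d circ_circ_circ[OF assms] circ_circ_circ[OF assms(3,2,1,4)]
      c[OF hom(5) dot_in_V[OF hom(2,3)]] c[OF hom(6) dot_in_V[OF hom(3,1)]]
      c[OF hom(7) dot_in_V[OF hom(1,2)]]
    using assms by (cases p; cases q; cases r)
      (simp_all add: dot_eq circ_eq[of _ "\<alpha> (\<alpha> u)"] bilinear_simps \<alpha>_star star_assoc algebra_simps)
qed

end

end

theorem proposition4p3:
  fixes scale :: "'k::{alg_closed_field, field_char_0} \<Rightarrow> 'a::ab_group_add \<Rightarrow> 'a"
    and V :: "bit \<Rightarrow> 'a set"
    and prec succ :: "'a \<Rightarrow> 'a \<Rightarrow> 'a"
    and \<alpha> :: "'a \<Rightarrow> 'a"
  assumes "hom_dendriform_superalgebra scale V prec succ \<alpha>"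
  shows "(\<exists>!circ. hom_dendriform_superalgebra.induced_product scale V prec succ circ) \<and>
    (\<forall>circ. hom_dendriform_superalgebra.induced_product scale V prec succ circ \<longrightarrow>
       hom_pre_Jordan_superalgebra scale V circ \<alpha>)"
proof -
  interpret hom_dendriform_superalgebra scale V prec succ \<alpha> by fact
  have "hom_pre_Jordan_superalgebra scale V circ \<alpha>" if "induced_product circ" for circ
    by (intro hom_pre_Jordan_superalgebra.intro hom_superalgebra_circ
        hom_pre_Jordan_superalgebra_axioms.intro pre_Jordan_1_circ pre_Jordan_2_circ that)
  with ex1_induced_product show ?thesis by blast
qed

end
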